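(* For $n\ge 0$ let $s_n=\mathrm{ct}\left[(x^{-1}+1+x)^n x\right]$, and let $p$ be a prime. The asymptotic density $D_0$ of $0$ in $(s_n\bmod p)_{n\ge0}$ is $1$ if $p\mid T_n$ for some $0\le n<p$, and otherwise, for $p>2$, it is $$D_0=\frac{\left|\{0\le m<p-1 : T_m\equiv T_{p-1}T_{m+1}\}\right|+p\left|\{0\le m<p-1 : T_m\equiv T_{m+1}\}\right|}{(p-1)(p+1)},$$ where $m$ ranges over integers and congruences are modulo $p$. Additionally, for $p>2$, $D_0\geq\frac{1}{p-1}$.
   Context: For a Laurent polynomial $Q(x)$, $\mathrm{ct}[Q(x)]$ denotes its constant term. $T_n=\mathrm{ct}\left[(x^{-1}+1+x)^n\right]$ for $n\ge0$ (central trinomial coefficients). The sequence $s_n$ is OEIS A005717. The asymptotic density of a set $S\subseteq\mathbb{N}=\{0,1,2,\dots\}$ is $\lim_{N\to\infty}\frac{|S\cap\{n\in\mathbb{N}: n<N\}|}{N}$; the density of a value $x\in\mathbb{F}_p$ in a sequence $(c_n)$ over $\mathbb{F}_p$ is the asymptotic density of $\{n\in\mathbb{N}: c_n=x\}$. Saying that a density equals a number includes the assertion that the limit exists. *)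

theory Defs
  imports Complex_Main "HOL-Library.Poly_Mapping" "HOL-Number_Theory.Cong"
begin

text \<open>
  Laurent polynomials in one variable are finitely supported maps from integer exponents to
  coefficients; the multiplication of \<^type>\<open>poly_mapping\<close> is convolution.
\<close>

type_synonym 'a laurent_poly = "int \<Rightarrow>\<^sub>0 'a"

definition lmonom :: "int \<Rightarrow> 'a::zero_neq_one laurent_poly" where
  "lmonom k = Poly_Mapping.single k 1"

definition ct :: "'a::zero laurent_poly \<Rightarrow> 'a" where
  "ct Q = Poly_Mapping.lookup Q 0"

definition central_trinomial :: "nat \<Rightarrow> int" where
  "central_trinomial n = ct ((lmonom (-1) + 1 + lmonom 1) ^ n)"

definition trinomial_s :: "nat \<Rightarrow> int" where
  "trinomial_s n = ct ((lmonom (-1) + 1 + lmonom 1) ^ n * lmonom 1)"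

definition has_asymptotic_density :: "nat set \<Rightarrow> real \<Rightarrow> bool" where
  "has_asymptotic_density S d \<longleftrightarrow>
     (\<lambda>N::nat. real (card (S \<inter> {n. n < N})) / real N) \<longlonglongrightarrow> d"

text \<open>
  Elements of the field with \<open>p\<close> elements are represented by integers up to congruence
  modulo \<open>p\<close>, so \<open>c\<close> and \<open>x\<close> below stand for their reductions modulo \<open>p\<close>.
\<close>

definition has_value_density_mod :: "nat \<Rightarrow> (nat \<Rightarrow> int) \<Rightarrow> int \<Rightarrow> real \<Rightarrow> bool" where
  "has_value_density_mod p c x d \<longleftrightarrow> has_asymptotic_density {n. [c n = x] (mod int p)} d"

end

theory Submission
  imports Defs "HOL-Computational_Algebra.Primes"
begin

text \<open>
  Since \<open>T\<^sub>n\<^sub>+\<^sub>1 = T\<^sub>n + 2 s\<^sub>n\<close>, for odd \<open>p\<close> the zeros of \<open>s\<^sub>n\<close> modulo \<open>p\<close> are the \<open>n\<close> with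
  \<open>T\<^sub>n \<equiv> T\<^sub>n\<^sub>+\<^sub>1\<close>, and the Lucas congruence \<open>T (p q + r) \<equiv> T q * T r\<close> reduces this to base \<open>p\<close>
  digits. If some digit \<open>m\<close> has \<open>T m \<equiv> 0\<close>, then almost every \<open>n\<close> contains it. Otherwise, with
  \<open>c = T (p - 1) \<equiv> \<plusminus>1\<close>, the sets \<open>{n. T n \<equiv> T (n + 1)}\<close> and \<open>{n. T n \<equiv> c * T (n + 1)}\<close> depend only on
  the last digit of \<open>n\<close>, except that a last digit \<open>p - 1\<close> is deleted and swaps the two sets; their
  densities solve the resulting pair of linear equations. The lower bound comes from the members
  \<open>0\<close> of the first set and \<open>0\<close> or \<open>p - 3\<close> of the second, as \<open>T (p - 3) \<equiv> - T (p - 2)\<close> by the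
  three-term recurrence.
\<close>

section \<open>Laurent polynomials and p-th powers of sums\<close>

lemma lookup_lmonom_mult:
  fixes Q :: "'a::comm_ring_1 laurent_poly"
  shows "Poly_Mapping.lookup (lmonom k * Q) j = Poly_Mapping.lookup Q (j - k)"
proof -
  have "j = k + q \<longleftrightarrow> q = j - k" for q
    by auto
  then show ?thesis
    by (simp add: lmonom_def lookup_mult lookup_single when_mult flip: diff_eq_eq)
qed

lemma lmonom_0: "lmonom 0 = 1"
  by (simp add: lmonom_def)

lemma lmonom_mult: "lmonom k * lmonom l = (lmonom (k + l) :: 'a::comm_ring_1 laurent_poly)"
  by (simp add: lmonom_def mult_single)

lemma lmonom_power: "lmonom k ^ n = (lmonom (int n * k) :: 'a::comm_ring_1 laurent_poly)"
  by (induction n) (simp_all add: lmonom_0 lmonom_mult algebra_simps)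

lemma lookup_of_nat_mult:
  fixes Q :: "'a::comm_ring_1 laurent_poly"
  shows "Poly_Mapping.lookup (of_nat n * Q) j = of_nat n * Poly_Mapping.lookup Q j"
  by (induction n) (simp_all add: lookup_add algebra_simps)

text \<open>For 0 < k < p the coefficient \<open>p choose k\<close> is a multiple of p. The result
  is phrased as divisibility because integer Laurent polynomials have characteristic 0.\<close>

lemma prime_dvd_power_add:
  fixes a b :: "'a::comm_ring_1"
  assumes "prime p"
  shows "of_nat p dvd (a + b) ^ p - (a ^ p + b ^ p)"
proof -
  let ?f = "\<lambda>k. of_nat (p choose k) * a ^ k * b ^ (p - k)"
  have "p > 0"
    using assms by (rule prime_gt_0_nat)
  then have "{..p} = insert 0 (insert p {1..<p})"
    by auto
  then have "(a + b) ^ p = b ^ p + (a ^ p + (\<Sum>k\<in>{1..<p}. ?f k))"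
    using \<open>p > 0\<close> by (simp add: binomial_ring)
  moreover have "of_nat p dvd (\<Sum>k\<in>{1..<p}. ?f k)"
  proof (intro dvd_sum dvd_mult2)
    fix k assume "k \<in> {1..<p}"
    then have "p dvd p choose k"
      using assms by (intro dvd_choose_prime) auto
    then show "(of_nat p :: 'a) dvd of_nat (p choose k)"
      by (auto elim!: dvdE)
  qed
  ultimately show ?thesis
    by simp
qed

section \<open>Coefficients of the powers of x^-1 + 1 + x\<close>

definition trinomial :: "int laurent_poly" where
  "trinomial = lmonom (- 1) + 1 + lmonom 1"

text \<open>Off-centre coefficients are needed too, as Pascal's rule and the congruences modulo p
  mix different exponents.\<close>

definition tcoeff :: "nat \<Rightarrow> int \<Rightarrow> int" where
  "tcoeff n j = Poly_Mapping.lookup (trinomial ^ n) j"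

lemma tcoeff_0: "tcoeff 0 j = (if j = 0 then 1 else 0)"
  by (simp add: tcoeff_def lookup_one when_def)

lemma tcoeff_Suc: "tcoeff (Suc n) j = tcoeff n (j - 1) + tcoeff n j + tcoeff n (j + 1)"
  by (simp add: tcoeff_def trinomial_def distrib_right lookup_add lookup_lmonom_mult)

lemma tcoeff_minus: "tcoeff n (- j) = tcoeff n j"
proof (induction n arbitrary: j)
  case (Suc n)
  then show ?case
    using Suc[of "j + 1"] Suc[of "j - 1"] by (simp add: tcoeff_Suc)
qed (simp add: tcoeff_0)

lemma tcoeff_outside: "int n < \<bar>j\<bar> \<Longrightarrow> tcoeff n j = 0"
  by (induction n arbitrary: j) (simp_all add: tcoeff_0 tcoeff_Suc)

lemma tcoeff_bottom: "tcoeff n (- int n) = 1"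
  by (induction n) (simp_all add: tcoeff_0 tcoeff_Suc tcoeff_outside)

lemma central_trinomial_tcoeff: "central_trinomial n = tcoeff n 0"
  by (simp add: central_trinomial_def tcoeff_def ct_def trinomial_def)

lemma trinomial_s_tcoeff: "trinomial_s n = tcoeff n 1"
  using tcoeff_minus[of n 1]
  by (simp add: trinomial_s_def tcoeff_def ct_def trinomial_def mult.commute[of _ "lmonom 1"]
      lookup_lmonom_mult)

lemma central_trinomial_0: "central_trinomial 0 = 1"
  by (simp add: central_trinomial_tcoeff tcoeff_0)

lemma central_trinomial_1: "central_trinomial (Suc 0) = 1"
  by (simp add: central_trinomial_tcoeff tcoeff_Suc tcoeff_0)

text \<open>By symmetry the two neighbours of the central coefficient agree. This turns zeros of
  \<open>trinomial_s\<close> modulo an odd prime into coincidences of consecutive central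
  coefficients.\<close>

lemma central_trinomial_Suc: "central_trinomial (Suc n) = central_trinomial n + 2 * trinomial_s n"
  using tcoeff_minus[of n 1] by (simp add: central_trinomial_tcoeff trinomial_s_tcoeff tcoeff_Suc)

text \<open>Serves to exclude p = 2 from the case where p divides some central coefficient.\<close>

lemma odd_central_trinomial: "odd (central_trinomial n)"
  by (induction n) (simp_all add: central_trinomial_0 central_trinomial_Suc)

text \<open>Coefficientwise form of the derivation \<open>x d/dx\<close> applied to a power.\<close>

lemma tcoeff_deriv: "j * tcoeff (Suc n) j = int (Suc n) * (tcoeff n (j - 1) - tcoeff n (j + 1))"
proof (induction n arbitrary: j)
  case 0
  then show ?case
    by (simp add: tcoeff_0 tcoeff_Suc)
next
  case (Suc n)
  \<comment> \<open>On the outer terms \<open>j\<close> is split as (j - 1) + 1 and (j + 1) - 1, so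
    that the induction hypothesis applies to all three products.\<close>
  have "j * tcoeff (Suc (Suc n)) j =
      (j - 1) * tcoeff (Suc n) (j - 1) + j * tcoeff (Suc n) j + (j + 1) * tcoeff (Suc n) (j + 1)
      + tcoeff (Suc n) (j - 1) - tcoeff (Suc n) (j + 1)"
    by (subst tcoeff_Suc) (simp add: algebra_simps)
  also have "\<dots> = int (Suc (Suc n)) * (tcoeff (Suc n) (j - 1) - tcoeff (Suc n) (j + 1))"
    unfolding Suc by (simp add: tcoeff_Suc algebra_simps)
  finally show ?case .
qed

text \<open>Comes from \<open>tcoeff_deriv\<close> at exponent 1: Pascal's rule eliminates the
  coefficient at exponent 2, and \<open>central_trinomial_Suc\<close> then eliminates
  \<open>trinomial_s\<close>.\<close>

lemma central_trinomial_rec: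
  "(int n + 2) * central_trinomial (Suc (Suc n)) =
    (2 * int n + 3) * central_trinomial (Suc n) + 3 * (int n + 1) * central_trinomial n"
proof -
  have "trinomial_s (Suc n) = (int n + 1) * (central_trinomial n - tcoeff n 2)"
    using tcoeff_deriv[of 1 n] by (simp add: trinomial_s_tcoeff central_trinomial_tcoeff algebra_simps)
  moreover have "tcoeff n 2 = trinomial_s (Suc n) - central_trinomial n - trinomial_s n"
    by (simp add: trinomial_s_tcoeff central_trinomial_tcoeff tcoeff_Suc)
  ultimately have "(int n + 2) * trinomial_s (Suc n) =
      (int n + 1) * (2 * central_trinomial n + trinomial_s n)"
    by (simp add: algebra_simps)
  then show ?thesis
    unfolding central_trinomial_Suc by (simp add: algebra_simps)
qed

section \<open>The Lucas congruence\<close>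

text \<open>Two applications of \<open>prime_dvd_power_add\<close> peel off the three summands one
  after the other.\<close>

lemma trinomial_power_prime:
  assumes "prime p"
  obtains R where "trinomial ^ p = lmonom (- int p) + 1 + lmonom (int p) + of_nat p * R"
proof -
  have "of_nat p dvd ((lmonom (- 1) + 1) + lmonom 1 :: int laurent_poly) ^ p
      - ((lmonom (- 1) + 1) ^ p + lmonom 1 ^ p)"
    "of_nat p dvd (lmonom (- 1) + 1 :: int laurent_poly) ^ p - (lmonom (- 1) ^ p + 1 ^ p)"
    using assms by (rule prime_dvd_power_add)+
  from dvd_add[OF this] have "of_nat p dvd trinomial ^ p - (lmonom (- int p) + 1 + lmonom (int p))"
    by (simp add: trinomial_def lmonom_power algebra_simps)
  then obtain R where "trinomial ^ p - (lmonom (- int p) + 1 + lmonom (int p)) = of_nat p * R" ..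
  then have "trinomial ^ p = lmonom (- int p) + 1 + lmonom (int p) + of_nat p * R"
    by (simp add: algebra_simps)
  then show ?thesis
    by (rule that)
qed

lemma tcoeff_add_prime:
  assumes "prime p"
  shows "[tcoeff (p + n) j = tcoeff n (j - int p) + tcoeff n j + tcoeff n (j + int p)] (mod int p)"
proof -
  obtain R where R: "trinomial ^ p = lmonom (- int p) + 1 + lmonom (int p) + of_nat p * R"
    using trinomial_power_prime[OF assms] .
  have "tcoeff (p + n) j = tcoeff n (j - int p) + tcoeff n j + tcoeff n (j + int p)
      + int p * Poly_Mapping.lookup (R * trinomial ^ n) j"
    by (simp add: tcoeff_def power_add R distrib_right lookup_add lookup_lmonom_mult mult.assoc
        lookup_of_nat_mult)
  then show ?thesis
    by (simp add: cong_def)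
qed

text \<open>Modulo p, adding p to the row acts on the exponents p * l as Pascal's rule acts on l, so
  the induction must treat all l together. In the base case p * l lies outside row m unless l =
  0.\<close>

lemma tcoeff_prime_mult_add:
  assumes "prime p" "m < p"
  shows "[tcoeff (p * n + m) (int p * l) = tcoeff n l * central_trinomial m] (mod int p)"
proof (induction n arbitrary: l)
  case 0
  show ?case
  proof (cases "l = 0")
    case True
    then show ?thesis
      by (simp add: tcoeff_0 central_trinomial_tcoeff)
  next
    case False
    then have "int p * 1 \<le> int p * \<bar>l\<bar>"
      by (intro mult_left_mono) auto
    then have "int m < \<bar>int p * l\<bar>"
      using assms unfolding abs_mult by linarith
    then show ?thesis
      using False by (simp add: tcoeff_0 tcoeff_outside)
  qed
next
  case (Suc n)
  have step: "[tcoeff (p * Suc n + m) (int p * l) = tcoeff (p * n + m) (int p * (l - 1))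
      + tcoeff (p * n + m) (int p * l) + tcoeff (p * n + m) (int p * (l + 1))] (mod int p)"
    using tcoeff_add_prime[OF assms(1), of "p * n + m" "int p * l"]
    by (simp add: algebra_simps)
  show ?case
    unfolding tcoeff_Suc distrib_right by (rule cong_trans[OF step]) (intro cong_add Suc)
qed

lemma central_trinomial_lucas:
  assumes "prime p" "m < p"
  shows "[central_trinomial (p * n + m) = central_trinomial n * central_trinomial m] (mod int p)"
  using tcoeff_prime_mult_add[OF assms, of n 0] by (simp add: central_trinomial_tcoeff)

section \<open>Central coefficients with index just below p\<close>

text \<open>
  Modulo \<open>p\<close>, the polynomial \<open>(1 + x + x\<^sup>2)\<^bsup>p-1\<^esup>\<close> agrees with
  \<open>1/(1 + x + x\<^sup>2) = (1 - x)/(1 - x\<^sup>3)\<close> below degree \<open>p\<close>.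
\<close>

lemma tcoeff_prime_minus_1:
  assumes "prime p" "Suc i < p"
  shows "[tcoeff (p - 1) (int i - int (p - 1)) =
      (if i mod 3 = 0 then 1 else if i mod 3 = 1 then - 1 else 0)] (mod int p) \<and>
    [tcoeff (p - 1) (int (Suc i) - int (p - 1)) =
      (if Suc i mod 3 = 0 then 1 else if Suc i mod 3 = 1 then - 1 else 0)] (mod int p)"
  using assms(2)
proof (induction i)
  \<comment> \<open>Row p vanishes modulo p strictly between the exponents -p and 0, so three
    consecutive entries of row p - 1 centred there sum to 0. As this recurrence has order two, the
    induction carries two consecutive entries.\<close>
  have *: "[tcoeff (p - 1) (j - 1) + tcoeff (p - 1) j + tcoeff (p - 1) (j + 1) = 0] (mod int p)"
    if "- int p < j" "j < 0" for j
  proof -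
    have "[tcoeff p j = 0] (mod int p)"
      using tcoeff_add_prime[OF assms(1), of 0 j] that by (simp add: tcoeff_0)
    moreover have "Suc (p - 1) = p"
      using assms by simp
    ultimately show ?thesis
      using tcoeff_Suc[of "p - 1" j] by simp
  qed
  {
    case 0
    then show ?case
      using *[of "- int (p - 1)"] tcoeff_bottom[of "p - 1"]
      by (simp add: tcoeff_outside cong_iff_dvd_diff of_nat_diff algebra_simps)
  next
    case (Suc i)
    let ?a = "\<lambda>i. tcoeff (p - 1) (int i - int (p - 1))"
    have "[?a i + ?a (Suc i) + ?a (Suc (Suc i)) = 0] (mod int p)"
      using *[of "int (Suc i) - int (p - 1)"] Suc.prems by (simp add: of_nat_diff algebra_simps)
    moreover have "[?a i = (if i mod 3 = 0 then 1 else if i mod 3 = 1 then - 1 else 0)] (mod int p)"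
      and new: "[?a (Suc i) = (if Suc i mod 3 = 0 then 1 else if Suc i mod 3 = 1 then - 1 else 0)]
        (mod int p)"
      using Suc by auto
    ultimately have "[?a i + ?a (Suc i) + ?a (Suc (Suc i)) - ?a i - ?a (Suc i) = 0
        - (if i mod 3 = 0 then 1 else if i mod 3 = 1 then - 1 else 0)
        - (if Suc i mod 3 = 0 then 1 else if Suc i mod 3 = 1 then - 1 else 0)] (mod int p)"
      by (intro cong_diff)
    moreover have "i mod 3 = 0 \<or> i mod 3 = 1 \<or> i mod 3 = 2"
      by auto
    ultimately have "[?a (Suc (Suc i)) =
      (if Suc (Suc i) mod 3 = 0 then 1 else if Suc (Suc i) mod 3 = 1 then - 1 else 0)] (mod int p)"
      by (auto simp: mod_Suc split: if_splits)
    with new show ?case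
      by blast
  }
qed

text \<open>The centre of row p - 1 has offset p - 1 from the left end; an offset of 2 modulo 3, the
  only one giving 0, would force 3 to divide p.\<close>

lemma central_trinomial_prime_minus_1:
  assumes "prime p" "p > 3"
  shows "[central_trinomial (p - 1) = 1] (mod int p) \<or> [central_trinomial (p - 1) = - 1] (mod int p)"
proof -
  define i where "i = p - 2"
  have i: "Suc i < p" "int (Suc i) - int (p - 1) = 0" "p = Suc (Suc i)"
    using assms by (auto simp: i_def)
  have "\<not> 3 dvd p"
    using assms by (auto simp: prime_nat_iff)
  then have "Suc i mod 3 = 0 \<or> Suc i mod 3 = 1"
    unfolding i(3) by presburger
  then show ?thesis
    using tcoeff_prime_minus_1[OF assms(1) i(1)] unfolding i(2)
    by (auto simp: central_trinomial_tcoeff)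
qed

text \<open>The value is 3. Hence p = 3 falls under the case of density 1.\<close>

lemma three_dvd_central_trinomial_2: "3 dvd central_trinomial 2"
  using central_trinomial_rec[of 0]
  by (simp add: central_trinomial_0 central_trinomial_1 numeral_2_eq_2)

lemma central_trinomial_prime_minus_3:
  assumes "prime p" "p > 3"
  shows "[central_trinomial (p - 3) = - central_trinomial (p - 2)] (mod int p)"
proof -
  define n where "n = p - 3"
  have p: "p = n + 3"
    using assms by (simp add: n_def)
  let ?T = "central_trinomial"
  have r: "(int n + 2) * ?T (Suc (Suc n)) = (2 * int n + 3) * ?T (Suc n) + 3 * (int n + 1) * ?T n"
    "(int n + 3) * ?T (Suc (Suc (Suc n))) =
      (2 * int n + 5) * ?T (Suc (Suc n)) + 3 * (int n + 2) * ?T (Suc n)"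
    using central_trinomial_rec[of n] central_trinomial_rec[of "Suc n"]
    by (simp_all add: algebra_simps)
  \<comment> \<open>With n = -3 modulo p, the relations read T (n + 2) = 3 T (n + 1) + 6 T n and T
    (n + 2) = - 3 T (n + 1). Their difference leaves the factor 6, invertible since p > 3.\<close>
  have "6 * (?T n + ?T (Suc n)) = int p * (5 * ?T (Suc n) + 3 * ?T n
      + ?T (Suc (Suc n)) - ?T (Suc (Suc (Suc n))))"
    using r by (simp add: p algebra_simps)
  then have "int p dvd 6 * (?T n + ?T (Suc n))"
    by simp
  moreover have "coprime p 6"
  proof -
    have "coprime p q" if "prime q" "q \<le> 3" for q
      using assms that by (intro primes_coprime) auto
    from this[of 2] this[of 3] have "coprime p (2 * 3)"
      unfolding coprime_mult_right_iff by simp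
    then show ?thesis by simp
  qed
  then have "coprime (int p) 6"
    using coprime_int_iff[of p 6] by simp
  ultimately have "int p dvd ?T n + ?T (Suc n)"
    using coprime_dvd_mult_right_iff by blast
  then show ?thesis
    by (simp add: cong_iff_dvd_diff p)
qed

section \<open>Sublinear growth from a recursion on n div p\<close>

text \<open>Unrolling k times bounds f n / n by (\<rho> / p)^k plus a constant divided by n. First k
  is chosen to make the power small, then n to make the other term small.\<close>

lemma sublinear_of_div_recursion:
  fixes f :: "nat \<Rightarrow> real"
  assumes p: "p > 0" and \<rho>: "0 \<le> \<rho>" "\<rho> < real p"
    and nonneg: "\<And>n. 0 \<le> f n" and linear: "\<And>n. f n \<le> real n"
    and rec: "\<And>n. f n \<le> \<rho> * f (n div p) + K"
  shows "(\<lambda>n. f n / real n) \<longlonglongrightarrow> 0"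
proof -
  define C where "C k = (\<Sum>i<k. \<rho> ^ i * K)" for k
  have iter: "f n \<le> \<rho> ^ k * f (n div p ^ k) + C k" for n k
  proof (induction k)
    case 0
    then show ?case by (simp add: C_def)
  next
    case (Suc k)
    have "n div p ^ Suc k = n div p ^ k div p"
      by (simp only: power_Suc2 div_mult2_eq)
    then have "\<rho> ^ k * f (n div p ^ k) \<le> \<rho> ^ k * (\<rho> * f (n div p ^ Suc k) + K)"
      using rec[of "n div p ^ k"] \<rho>(1) by (intro mult_left_mono) auto
    with Suc show ?case
      by (simp add: C_def algebra_simps)
  qed
  show ?thesis
  proof (rule LIMSEQ_I)
    fix \<epsilon> :: real
    assume "\<epsilon> > 0"
    have "(\<lambda>k. (\<rho> / real p) ^ k) \<longlonglongrightarrow> 0"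
      using p \<rho> by (intro LIMSEQ_power_zero) auto
    then have "\<forall>\<^sub>F k in sequentially. (\<rho> / real p) ^ k < \<epsilon> / 2"
      using \<open>\<epsilon> > 0\<close> by (intro order_tendstoD) auto
    then obtain k where k: "(\<rho> / real p) ^ k < \<epsilon> / 2"
      by (auto simp: eventually_sequentially)
    have "(\<lambda>n. C k / real n) \<longlonglongrightarrow> 0"
      by (rule lim_const_over_n)
    then have "\<forall>\<^sub>F n in sequentially. C k / real n < \<epsilon> / 2"
      using \<open>\<epsilon> > 0\<close> by (intro order_tendstoD) auto
    then obtain N where N: "\<And>n. n \<ge> N \<Longrightarrow> C k / real n < \<epsilon> / 2"
      by (auto simp: eventually_sequentially)
    have "norm (f n / real n - 0) < \<epsilon>" if "n \<ge> Suc N" for n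
    proof -
      have "real (n div p ^ k) \<le> real n / real p ^ k"
        using of_nat_div_le_of_nat[of n "p ^ k", where 'a = real] by simp
      then have "f (n div p ^ k) \<le> real n / real p ^ k"
        using linear[of "n div p ^ k"] by linarith
      then have "\<rho> ^ k * f (n div p ^ k) \<le> \<rho> ^ k * (real n / real p ^ k)"
        using \<rho>(1) by (intro mult_left_mono) auto
      then have "f n \<le> \<rho> ^ k * (real n / real p ^ k) + C k"
        using iter[of n k] by linarith
      then have "f n / real n \<le> (\<rho> ^ k * (real n / real p ^ k) + C k) / real n"
        by (intro divide_right_mono) auto
      also have "\<dots> = (\<rho> / real p) ^ k + C k / real n"
        using that by (simp add: power_divide add_divide_distrib)
      also have "\<dots> < \<epsilon>"
        using k N[OF Suc_leD[OF that]] by linarith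
      finally show ?thesis
        using nonneg[of n] by simp
    qed
    then show "\<exists>N. \<forall>n\<ge>N. norm (f n / real n - 0) < \<epsilon>"
      by blast
  qed
qed

section \<open>Counting functions and densities of sets described by digits\<close>

definition count_below :: "nat set \<Rightarrow> nat \<Rightarrow> nat" where
  "count_below X N = card (X \<inter> {n. n < N})"

lemma count_below_le: "count_below X N \<le> N"
  unfolding count_below_def by (rule order_trans[OF card_mono[of "{..<N}"]]) auto

lemma count_below_0 [simp]: "count_below X 0 = 0"
  by (simp add: count_below_def)

lemma count_below_Suc: "count_below X (Suc N) = count_below X N + of_bool (N \<in> X)"
proof -
  have "X \<inter> {n. n < Suc N} =
      (if N \<in> X then insert N (X \<inter> {n. n < N}) else X \<inter> {n. n < N})"
    by (auto simp: less_Suc_eq)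
  then show ?thesis
    by (simp add: count_below_def)
qed

lemma count_below_add:
  "count_below X (M + N) = count_below X M + count_below {r. M + r \<in> X} N"
  by (induction N) (simp_all add: count_below_Suc)

lemma count_below_cong: "(\<And>n. n < N \<Longrightarrow> n \<in> X \<longleftrightarrow> n \<in> Y) \<Longrightarrow> count_below X N = count_below Y N"
  unfolding count_below_def by (rule arg_cong[of _ _ card]) auto

text \<open>Sorting by last digit suggests p * d X Y = a + d Y X, where a counts the members of X
  below p - 1, and the same with X and Y exchanged. The stated quotient solves this system.\<close>

lemma density_of_last_digit_swap:
  assumes p: "p > 1"
    and X: "\<And>q r. r < p - 1 \<Longrightarrow> p * q + r \<in> X \<longleftrightarrow> r \<in> X"
      "\<And>q. p * q + (p - 1) \<in> X \<longleftrightarrow> q \<in> Y"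
    and Y: "\<And>q r. r < p - 1 \<Longrightarrow> p * q + r \<in> Y \<longleftrightarrow> r \<in> Y"
      "\<And>q. p * q + (p - 1) \<in> Y \<longleftrightarrow> q \<in> X"
  shows "has_asymptotic_density X
    ((real (count_below Y (p - 1)) + real p * real (count_below X (p - 1)))
      / ((real p - 1) * (real p + 1)))"
proof -
  \<comment> \<open>The parameters shadow the fixed sets because every estimate is needed for both
    orders of the pair.\<close>
  define d where "d X Y = (real (count_below Y (p - 1)) + real p * real (count_below X (p - 1)))
    / ((real p - 1) * (real p + 1))" for X Y
  define e where "e X Y n = \<bar>real (count_below X n) - real n * d X Y\<bar>" for X Y n
  have d_bounds: "0 \<le> d X Y" "d X Y \<le> 1" for X Y
  proof -
    have "real (count_below Y (p - 1)) + real p * real (count_below X (p - 1))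
        \<le> real (p - 1) + real p * real (p - 1)"
      by (intro add_mono mult_left_mono) (simp_all only: of_nat_le_iff count_below_le of_nat_0_le_iff)
    also have "\<dots> = (real p - 1) * (real p + 1)"
      using p by (simp add: of_nat_diff algebra_simps)
    finally show "d X Y \<le> 1"
      using p by (simp add: d_def)
    show "0 \<le> d X Y"
      using p by (simp add: d_def)
  qed
  have d_eq: "real p * d X Y = real (count_below X (p - 1)) + d Y X" for X Y
    using p by (simp add: d_def divide_simps) (simp add: algebra_simps)
  have e_linear: "e X Y n \<le> real n" for X Y n
  proof -
    have "real (count_below X n) \<le> real n"
      by (simp add: count_below_le)
    moreover have "0 \<le> real n * d X Y" "real n * d X Y \<le> real n * 1"
      using d_bounds by (intro mult_nonneg_nonneg mult_left_mono; simp)+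
    ultimately show ?thesis
      unfolding e_def by simp
  qed
  \<comment> \<open>A full block of length p contributes a fixed count, plus one if its index lies
    in Y. By \<open>d_eq\<close> the fixed counts cancel, and the incomplete last block costs at
    most p.\<close>
  have e_rec: "e X Y n \<le> e Y X (n div p) + real p"
    if X: "\<And>q r. r < p - 1 \<Longrightarrow> p * q + r \<in> X \<longleftrightarrow> r \<in> X" "\<And>q. p * q + (p - 1) \<in> X \<longleftrightarrow> q \<in> Y"
    for X Y n
  proof -
    have block: "count_below {r. p * q + r \<in> X} p = count_below X (p - 1) + of_bool (q \<in> Y)" for q
    proof -
      have "p = Suc (p - 1)"
        using p by simp
      then have "count_below {r. p * q + r \<in> X} p
          = count_below {r. p * q + r \<in> X} (p - 1) + of_bool (p * q + (p - 1) \<in> X)"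
        using count_below_Suc[of "{r. p * q + r \<in> X}" "p - 1"] by simp
      then show ?thesis
        using X count_below_cong[of "p - 1" "{r. p * q + r \<in> X}" X] by simp
    qed
    have blocks: "count_below X (p * q) = q * count_below X (p - 1) + count_below Y q" for q
    proof (induction q)
      case 0
      then show ?case
        by (simp add: count_below_def)
    next
      case (Suc q)
      then show ?case
        using count_below_add[of X "p * q" p] block[of q] by (simp add: count_below_Suc add.commute)
    qed
    define q r where "q = n div p" and "r = n mod p"
    have n: "n = p * q + r" and r: "r < p"
      using p by (simp_all add: q_def r_def)
    let ?c = "count_below {i. p * q + i \<in> X} r"
    have "real n * d X Y = real q * (real p * d X Y) + real r * d X Y"
      by (simp add: n algebra_simps)
    moreover have "count_below X n = q * count_below X (p - 1) + count_below Y q + ?c"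
      by (simp only: n count_below_add blocks)
    ultimately have "real (count_below X n) - real n * d X Y
        = real (count_below Y q) - real q * d Y X + (real ?c - real r * d X Y)"
      unfolding d_eq by (simp add: algebra_simps)
    moreover have "real ?c \<le> real p" "0 \<le> real ?c"
      using count_below_le[of "{i. p * q + i \<in> X}" r] r by simp_all
    moreover have "0 \<le> real r * d X Y" "real r * d X Y \<le> real p * 1"
      using d_bounds r by (intro mult_nonneg_nonneg mult_mono; simp)+
    ultimately show ?thesis
      unfolding e_def q_def by linarith
  qed
  \<comment> \<open>The recursion exchanges the two errors; their maximum satisfies a recursion in
    itself, with factor 1 < p.\<close>
  define f where "f n = max (e X Y n) (e Y X n)" for n
  have "(\<lambda>n. f n / real n) \<longlonglongrightarrow> 0"
  proof (rule sublinear_of_div_recursion)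
    show "f n \<le> 1 * f (n div p) + real p" for n
      using e_rec[OF X, of n] e_rec[OF Y, of n] unfolding f_def by linarith
    show "f n \<le> real n" for n
      using e_linear by (simp add: f_def)
    show "0 \<le> f n" for n
      by (simp add: f_def e_def)
  qed (use p in auto)
  then have "(\<lambda>n. real (count_below X n) / real n - d X Y) \<longlonglongrightarrow> 0"
  proof (rule tendsto_0_le[where K = 1])
    show "\<forall>\<^sub>F n in sequentially. norm (real (count_below X n) / real n - d X Y) \<le> norm (f n / real n) * 1"
    proof (rule eventually_sequentiallyI[of 1])
      fix n :: nat
      assume "n \<ge> 1"
      then have "real (count_below X n) / real n - d X Y =
          (real (count_below X n) - real n * d X Y) / real n"
        by (simp add: diff_divide_distrib)
      then have "norm (real (count_below X n) / real n - d X Y) = e X Y n / real n"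
        by (simp add: e_def abs_divide)
      also have "\<dots> \<le> f n / real n"
        by (simp add: f_def divide_right_mono)
      also have "\<dots> \<le> norm (f n / real n) * 1"
        by (simp only: mult_1_right real_norm_def abs_ge_self)
      finally show "norm (real (count_below X n) / real n - d X Y) \<le> norm (f n / real n) * 1" .
    qed
  qed
  then show ?thesis
    unfolding has_asymptotic_density_def d_def count_below_def[of X] by (rule LIM_zero_cancel)
qed

text \<open>Each block of length p meets U in at most p - 1 points, and in none unless its index
  lies in U, so U has density 0. Any n outside S has n or n + 1 in U.\<close>

lemma density_1_of_missing_digit:
  assumes digits: "\<And>q r. r < p \<Longrightarrow> p * q + r \<in> U \<Longrightarrow> q \<in> U \<and> r \<in> U"
    and missing: "m < p" "m \<notin> U"
    and S: "\<And>n. n \<notin> U \<Longrightarrow> Suc n \<notin> U \<Longrightarrow> n \<in> S"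
  shows "has_asymptotic_density S 1"
proof -
  have p: "p > 0"
    using missing by simp
  have "U \<inter> {n. n < p} \<subseteq> {..<p} - {m}"
    using missing by auto
  from card_mono[OF _ this] have few: "count_below U p \<le> p - 1"
    using missing by (simp add: count_below_def)
  have block: "count_below {r. p * q + r \<in> U} p \<le> (p - 1) * of_bool (q \<in> U)" for q
  proof (cases "q \<in> U")
    case True
    have "count_below {r. p * q + r \<in> U} p \<le> count_below U p"
      unfolding count_below_def using digits by (intro card_mono) auto
    with few True show ?thesis
      by simp
  next
    case False
    then have "{r. p * q + r \<in> U} \<inter> {n. n < p} = {}"
      using digits by auto
    then show ?thesis
      by (simp add: count_below_def)
  qed
  have blocks: "count_below U (p * q) \<le> (p - 1) * count_below U q" for q
  proof (induction q)
    case 0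
    then show ?case
      by (simp add: count_below_def)
  next
    case (Suc q)
    then show ?case
      using count_below_add[of U "p * q" p] block[of q]
      by (simp add: count_below_Suc add.commute distrib_left)
  qed
  have rec: "count_below U n \<le> (p - 1) * count_below U (n div p) + p" for n
  proof -
    have "count_below U n = count_below U (p * (n div p)) + count_below {r. p * (n div p) + r \<in> U} (n mod p)"
      using count_below_add[of U "p * (n div p)" "n mod p"] by simp
    also have "\<dots> \<le> (p - 1) * count_below U (n div p) + p"
      using p by (intro add_mono blocks order_trans[OF count_below_le]) (simp add: less_imp_le)
    finally show ?thesis .
  qed
  have "(\<lambda>n. real (count_below U n) / real n) \<longlonglongrightarrow> 0"
  proof (rule sublinear_of_div_recursion)
    show "real (count_below U n) \<le> real (p - 1) * real (count_below U (n div p)) + real p" for n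
      using rec[of n] by (metis of_nat_add of_nat_le_iff of_nat_mult)
  qed (use p in \<open>auto simp: count_below_le\<close>)
  then have lim: "(\<lambda>n. 2 * (real (count_below U n) / real n) + 1 / real n) \<longlonglongrightarrow> 2 * 0 + 0"
    by (intro tendsto_intros lim_const_over_n)
  have "(\<lambda>n. real (count_below S n) / real n - 1) \<longlonglongrightarrow> 0"
  proof (rule tendsto_0_le[where K = 1])
    show "(\<lambda>n. 2 * (real (count_below U n) / real n) + 1 / real n) \<longlonglongrightarrow> 0"
      using lim by simp
    \<comment> \<open>U is counted once for n and once for its successor; the summand 1 accounts for
      n itself as the successor of n - 1.\<close>
    have many: "n \<le> count_below S n + 2 * count_below U n + 1" for n
    proof -
      have "n \<le> count_below S n + count_below U n + count_below U (Suc n)"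
      proof (induction n)
        case (Suc n)
        have "of_bool (n \<in> S) + of_bool (n \<in> U) + of_bool (Suc n \<in> U) \<ge> (1::nat)"
          using S[of n] by auto
        with Suc show ?case
          unfolding count_below_Suc by simp
      qed simp
      then show ?thesis
        by (cases "n \<in> U") (simp_all add: count_below_Suc)
    qed
    show "\<forall>\<^sub>F n in sequentially. norm (real (count_below S n) / real n - 1)
        \<le> norm (2 * (real (count_below U n) / real n) + 1 / real n) * 1"
    proof (rule eventually_sequentiallyI[of 1])
      fix n :: nat
      assume "n \<ge> 1"
      have "real n \<le> real (count_below S n) + 2 * real (count_below U n) + 1"
        using many[of n] by linarith
      moreover have "real (count_below S n) \<le> real n"
        by (simp add: count_below_le)
      moreover have "real (count_below S n) / real n - 1 =
          (real (count_below S n) - real n) / real n"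
        using \<open>n \<ge> 1\<close> by (simp add: diff_divide_distrib)
      ultimately have "norm (real (count_below S n) / real n - 1) \<le>
          (2 * real (count_below U n) + 1) / real n"
        by (simp add: divide_right_mono)
      also have "\<dots> \<le> norm (2 * (real (count_below U n) / real n) + 1 / real n) * 1"
        by (simp add: add_divide_distrib)
      finally show "norm (real (count_below S n) / real n - 1)
        \<le> norm (2 * (real (count_below U n) / real n) + 1 / real n) * 1" .
    qed
  qed
  then show ?thesis
    unfolding has_asymptotic_density_def count_below_def[of S] by (rule LIM_zero_cancel)
qed


section \<open>Density of the zeros of s_n modulo p\<close>

theorem proposition14:
  fixes p :: nat
  assumes "prime p"
  shows "((\<exists>n<p. int p dvd central_trinomial n) \<longrightarrow>
           has_value_density_mod p trinomial_s 0 1) \<and>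
         (\<not> (\<exists>n<p. int p dvd central_trinomial n) \<and> p > 2 \<longrightarrow>
           has_value_density_mod p trinomial_s 0
             ((real (card {m::nat. m < p - 1 \<and>
                 [central_trinomial m = central_trinomial (p - 1) * central_trinomial (m + 1)] (mod int p)})
               + real p * real (card {m::nat. m < p - 1 \<and>
                 [central_trinomial m = central_trinomial (m + 1)] (mod int p)}))
              / ((real p - 1) * (real p + 1)))) \<and>
         (p > 2 \<longrightarrow>
           (\<exists>D. has_value_density_mod p trinomial_s 0 D \<and> D \<ge> 1 / (real p - 1)))"
proof -
  define T :: "nat \<Rightarrow> int" where "T = central_trinomial"
  define A where "A = {n. [T n = T (Suc n)] (mod int p)}"
  define c where "c = T (p - 1)"
  \<comment> \<open>The partner of \<open>A\<close>: a last digit p - 1 puts the factor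
    \<open>c\<close> on \<open>T n\<close>, while the last digit 0 of n + 1 contributes 1.\<close>
  define B where "B = {n. [T n = c * T (Suc n)] (mod int p)}"
  define S where "S = {n. [trinomial_s n = 0] (mod int p)}"
  define D where "D = (real (count_below B (p - 1)) + real p * real (count_below A (p - 1)))
    / ((real p - 1) * (real p + 1))"
  have prime_dvd_mult: "int p dvd a * b \<longleftrightarrow> int p dvd a \<or> int p dvd b" for a b
    using assms by (simp add: prime_dvd_mult_iff)
  have p2: "p \<ge> 2"
    using assms by (rule prime_ge_2_nat)
  have lucas: "[T (p * n + m) = T n * T m] (mod int p)" if "m < p" for n m
    unfolding T_def using assms that by (rule central_trinomial_lucas)
  have T01: "T 0 = 1" "T (Suc 0) = 1"
    by (simp_all add: T_def central_trinomial_0 central_trinomial_1)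
  have S_iff: "n \<in> S \<longleftrightarrow> n \<in> A" if "p > 2" for n
  proof -
    have "\<not> int p dvd 2"
      using that by (auto dest: zdvd_imp_le)
    moreover have "T (Suc n) - T n = 2 * trinomial_s n"
      by (simp add: T_def central_trinomial_Suc)
    ultimately have "int p dvd T (Suc n) - T n \<longleftrightarrow> int p dvd trinomial_s n"
      by (simp add: prime_dvd_mult)
    then show ?thesis
      by (simp add: S_def A_def cong_iff_dvd_diff dvd_diff_commute[of _ "T n"])
  qed
  \<comment> \<open>By the Lucas congruence the indices with \<open>T n\<close> nonzero modulo p
    have all their digits among themselves. Oddness of \<open>T m\<close> rules out p = 2, which
    \<open>S_iff\<close> does not cover.\<close>
  have case1: "has_asymptotic_density S 1" if m: "m < p" "int p dvd T m" for m
  proof (rule density_1_of_missing_digit[of p "{n. \<not> int p dvd T n}" m])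
    have "p \<noteq> 2"
      using m odd_central_trinomial[of m] by (auto simp: T_def)
    with p2 have "p > 2"
      by simp
    then show "n \<in> S" if "n \<notin> {n. \<not> int p dvd T n}" "Suc n \<notin> {n. \<not> int p dvd T n}" for n
      using that by (simp add: S_iff A_def cong_iff_dvd_diff)
    show "q \<in> {n. \<not> int p dvd T n} \<and> r \<in> {n. \<not> int p dvd T n}"
      if "r < p" "p * q + r \<in> {n. \<not> int p dvd T n}" for q r
      using that cong_dvd_iff[OF lucas[of r q]] by (auto simp: prime_dvd_mult)
  qed (use m in auto)
  have case2: "has_asymptotic_density S D" and case2': "D \<ge> 1 / (real p - 1)"
    if units: "\<And>m. m < p \<Longrightarrow> \<not> int p dvd T m" and "p > 2"
  proof -
    have "p \<noteq> 3"
      using units[of 2] three_dvd_central_trinomial_2 by (auto simp: T_def)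
    with \<open>p > 2\<close> have "p > 3"
      by simp
    from central_trinomial_prime_minus_1[OF assms this]
    have c: "[c = 1] (mod int p) \<or> [c = - 1] (mod int p)"
      by (simp add: c_def T_def)
    then have "[c * c = 1] (mod int p)"
      using cong_mult[of c 1 "int p" c 1] cong_mult[of c "- 1" "int p" c "- 1"] by auto
    then have cc: "int p dvd c * c - 1"
      by (simp add: cong_iff_dvd_diff)
    have unit: "\<not> int p dvd T n" for n
    proof (induction n rule: less_induct)
      case (less n)
      show ?case
      proof (cases "n < p")
        case False
        then have "n div p < n" "n mod p < p"
          using p2 by auto
        then show ?thesis
          using cong_dvd_iff[OF lucas[of "n mod p" "n div p"]] less units
          by (auto simp: prime_dvd_mult)
      qed (use units in blast)
    qed
    have cancel: "[T n * a = T n * b] (mod int p) \<longleftrightarrow> [a = b] (mod int p)" for n a b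
      using unit[of n] prime_dvd_mult[of "T n" "a - b"]
      by (simp add: cong_iff_dvd_diff right_diff_distrib)
    \<comment> \<open>For r < p - 1 no carry occurs, so both sides share the factor
      \<open>T q\<close>, which is a unit modulo p.\<close>
    have low: "[T (p * q + r) = e * T (Suc (p * q + r))] (mod int p) \<longleftrightarrow>
        [T r = e * T (Suc r)] (mod int p)" if "r < p - 1" for q r e
    proof -
      have "[T (p * q + r) = T q * T r] (mod int p)"
        "[e * T (Suc (p * q + r)) = T q * (e * T (Suc r))] (mod int p)"
        using lucas[of r q] cong_scalar_left[OF lucas[of "Suc r" q], of e] that
        by (simp_all add: mult_ac)
      then show ?thesis
        using cancel[of q "T r" "e * T (Suc r)"] by (metis cong_sym cong_trans)
    qed
    \<comment> \<open>The carry turns the last digit p - 1 into 0 and q into q + 1.\<close>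
    have high: "[T (p * q + (p - 1)) = e * T (Suc (p * q + (p - 1)))] (mod int p) \<longleftrightarrow>
        [c * T q = e * T (Suc q)] (mod int p)" for q e
    proof -
      have "Suc (p * q + (p - 1)) = p * Suc q + 0"
        using p2 by simp
      then have "[e * T (Suc (p * q + (p - 1))) = e * T (Suc q)] (mod int p)"
        using cong_scalar_left[OF lucas[of 0 "Suc q"], of e] p2 T01 by (simp add: add.commute)
      moreover have "[T (p * q + (p - 1)) = c * T q] (mod int p)"
        using lucas[of "p - 1" q] p2 by (simp add: c_def mult.commute)
      ultimately show ?thesis
        by (metis cong_sym cong_trans)
    qed
    have c_unit: "\<not> int p dvd c"
      using unit c_def by simp
    \<comment> \<open>\<open>c\<close> is its own inverse modulo p, so it can be moved across a
      congruence.\<close>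
    have flip: "[c * a = b] (mod int p) \<longleftrightarrow> [a = c * b] (mod int p)" for a b
    proof -
      have "c * (c * a - b) = (c * c - 1) * a + (a - c * b)"
        by (simp add: algebra_simps)
      moreover have "int p dvd (c * c - 1) * a"
        using cc by simp
      ultimately have "int p dvd c * (c * a - b) \<longleftrightarrow> int p dvd a - c * b"
        by (simp add: dvd_add_right_iff)
      then show ?thesis
        using c_unit by (simp add: cong_iff_dvd_diff prime_dvd_mult)
    qed
    have "has_asymptotic_density A D"
      unfolding D_def
    proof (rule density_of_last_digit_swap)
      show "p * q + (p - 1) \<in> A \<longleftrightarrow> q \<in> B" for q
        using high[of q 1] flip by (simp add: A_def B_def)
      show "p * q + (p - 1) \<in> B \<longleftrightarrow> q \<in> A" for q
        using high[of q c] c_unit prime_dvd_mult[of c "T q - T (Suc q)"]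
        by (simp add: A_def B_def cong_iff_dvd_diff right_diff_distrib)
      show "p * q + r \<in> A \<longleftrightarrow> r \<in> A" if "r < p - 1" for q r
        using low[OF that, of q 1] by (simp add: A_def)
      show "p * q + r \<in> B \<longleftrightarrow> r \<in> B" if "r < p - 1" for q r
        using low[OF that, of q c] by (simp add: B_def)
    qed (use p2 in simp)
    moreover have "S = A"
      using S_iff \<open>p > 2\<close> by blast
    ultimately show "has_asymptotic_density S D"
      by simp
    have pos: "count_below X (p - 1) \<ge> 1" if "m \<in> X" "m < p - 1" for X m
      using that by (auto simp: count_below_def Suc_le_eq card_gt_0_iff)
    have "count_below A (p - 1) \<ge> 1"
      using p2 \<open>p > 2\<close> T01 by (intro pos[of 0]) (auto simp: A_def)
    \<comment> \<open>The witness is 0 if \<open>c\<close> is 1, since T 0 = T 1, and p - 3 if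
      \<open>c\<close> is -1.\<close>
    moreover have "count_below B (p - 1) \<ge> 1"
      using c
    proof
      assume "[c = 1] (mod int p)"
      then show ?thesis
        using \<open>p > 2\<close> T01 by (intro pos[of 0]) (auto simp: B_def cong_sym_eq)
    next
      assume "[c = - 1] (mod int p)"
      from cong_scalar_right[OF this, of "T (p - 2)"]
      have "[c * T (p - 2) = - T (p - 2)] (mod int p)"
        by simp
      then have "[T (p - 3) = c * T (p - 2)] (mod int p)"
        using central_trinomial_prime_minus_3[OF assms \<open>p > 3\<close>] unfolding T_def
        by (metis cong_sym cong_trans)
      moreover have "Suc (p - 3) = p - 2"
        using \<open>p > 3\<close> by simp
      ultimately show ?thesis
        using \<open>p > 3\<close> by (intro pos[of "p - 3"]) (auto simp: B_def)
    qed
    \<comment> \<open>One member of each set makes the numerator at least p + 1, which cancels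
      against the denominator.\<close>
    ultimately have "1 + real p * 1 \<le> real (count_below B (p - 1)) + real p * real (count_below A (p - 1))"
      by (intro add_mono mult_left_mono) simp_all
    then have "(real p + 1) / ((real p - 1) * (real p + 1)) \<le> D"
      unfolding D_def using p2 by (intro divide_right_mono) auto
    then show "D \<ge> 1 / (real p - 1)"
      by simp
  qed
  have "{m. m < p - 1 \<and> [central_trinomial m = central_trinomial (p - 1) * central_trinomial (m + 1)] (mod int p)}
      = B \<inter> {m. m < p - 1}"
    and "{m. m < p - 1 \<and> [central_trinomial m = central_trinomial (m + 1)] (mod int p)}
      = A \<inter> {m. m < p - 1}"
    by (auto simp: A_def B_def c_def T_def)
  then have D_eq: "(real (card {m. m < p - 1 \<and>
      [central_trinomial m = central_trinomial (p - 1) * central_trinomial (m + 1)] (mod int p)})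
      + real p * real (card {m. m < p - 1 \<and>
      [central_trinomial m = central_trinomial (m + 1)] (mod int p)}))
      / ((real p - 1) * (real p + 1)) = D"
    by (simp add: D_def count_below_def)
  \<comment> \<open>The lower bound in the case of density 1.\<close>
  have "1 \<ge> 1 / (real p - 1)"
    using p2 by simp
  then have bound: "\<exists>D. has_asymptotic_density S D \<and> D \<ge> 1 / (real p - 1)" if "p > 2"
    using that case1 case2 case2' by (cases "\<exists>m<p. int p dvd T m") blast+
  show ?thesis
    unfolding D_eq has_value_density_mod_def
    using case1 case2 bound unfolding S_def T_def by (intro conjI impI) blast+
qed

end
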